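(* Suppose that $f(X_1,\dots,X_d)\in L^1$ and $\mu>0$. Then almost surely $N_-(x)<\infty$ and $N_+(x)<\infty$ for every $x<\infty$ ($x>0$), and, for both choices of sign $\pm$, $$\frac{N_\pm(x)}{x^{1/d}}\longrightarrow\Bigl(\frac{d!}{\mu}\Bigr)^{1/d}\quad\text{almost surely, as }x\to\infty.$$
   Context: $X_1,X_2,\dots$ is an i.i.d. sequence of random variables with values in an arbitrary measurable space $(S,\mathcal S)$; $d\ge1$ is a fixed integer and $f:S^d\to\mathbb R$ is measurable (no symmetry assumed). $U_n:=\sum_{1\le i_1<\dots<i_d\le n}f(X_{i_1},\dots,X_{i_d})$ for $n\ge0$ (so $U_n=0$ for $n<d$), and $\mu:=\mathbb E f(X_1,\dots,X_d)$. For $x>0$, $$N_-(x):=\sup\{n\ge0:U_n\le x\},\qquad N_+(x):=\inf\{n\ge0:U_n>x\}.$$ *)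

theory Defs
  imports "HOL-Probability.Probability"
begin

text \<open>
  The sequence \<open>X\<close> is indexed from 1, as \<open>X 1, X 2, \<dots>\<close>; the value of \<open>X 0\<close> plays no role.
  Independence in the sense of \<open>indep_vars\<close> includes measurability of each \<open>X i\<close>.
\<close>

definition iid_sequence ::
  "'a measure \<Rightarrow> 's measure \<Rightarrow> (nat \<Rightarrow> 'a \<Rightarrow> 's) \<Rightarrow> bool" where
  "iid_sequence M S X \<longleftrightarrow>
     prob_space.indep_vars M (\<lambda>_. S) X {1..} \<and>
     (\<forall>i\<ge>1. distr M S (X i) = distr M S (X 1))"

text \<open>
  A point of \<open>S\<^sup>d\<close> is an element of \<open>PiM {1..d} (\<lambda>_. S)\<close>, i.e. an extensional function
  on \<open>{1..d}\<close>. The multi-indices \<open>1 \<le> i\<^sub>1 < \<dots> < i\<^sub>d \<le> n\<close> are the strictly increasing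
  functions from \<open>{1..d}\<close> to \<open>{1..n}\<close>.
\<close>

definition incr_indices :: "nat \<Rightarrow> nat \<Rightarrow> (nat \<Rightarrow> nat) set" where
  "incr_indices d n = {i \<in> {1..d} \<rightarrow>\<^sub>E {1..n}. strict_mono_on {1..d} i}"

definition U_stat ::
  "nat \<Rightarrow> ((nat \<Rightarrow> 's) \<Rightarrow> real) \<Rightarrow> (nat \<Rightarrow> 'a \<Rightarrow> 's) \<Rightarrow> nat \<Rightarrow> 'a \<Rightarrow> real" where
  "U_stat d f X n \<omega> = (\<Sum>i\<in>incr_indices d n. f (\<lambda>k\<in>{1..d}. X (i k) \<omega>))"

text \<open>
  The supremum and infimum are taken in \<open>enat\<close>: the supremum of an unbounded set and the
  infimum of the empty set are \<open>\<infinity>\<close>.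
\<close>

definition N_minus ::
  "nat \<Rightarrow> ((nat \<Rightarrow> 's) \<Rightarrow> real) \<Rightarrow> (nat \<Rightarrow> 'a \<Rightarrow> 's) \<Rightarrow> real \<Rightarrow> 'a \<Rightarrow> enat" where
  "N_minus d f X x \<omega> = Sup {enat n |n. U_stat d f X n \<omega> \<le> x}"

definition N_plus ::
  "nat \<Rightarrow> ((nat \<Rightarrow> 's) \<Rightarrow> real) \<Rightarrow> (nat \<Rightarrow> 'a \<Rightarrow> 's) \<Rightarrow> real \<Rightarrow> 'a \<Rightarrow> enat" where
  "N_plus d f X x \<omega> = Inf {enat n |n. U_stat d f X n \<omega> > x}"

end

theory Submission
  imports Defs "HOL-Library.Discrete_Functions"
begin

text \<open>
  Everything follows from the strong law \<open>U\<^sub>n / n\<^sup>d \<longlonglongrightarrow> \<mu> / d!\<close>, since \<open>U\<close> crosses the level \<open>x\<close> next to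
  \<open>N\<^sub>\<plusminus>(x)\<close>. For bounded kernels the variance of \<open>U\<^sub>n\<close> is \<open>O(n\<^bsup>2d-1\<^esup>)\<close>, so the strong law holds along the
  squares, and \<open>U\<close> varies little between consecutive squares. A general kernel \<open>f\<close> is
  truncated; the error is controlled for all \<open>n\<close> at once by a weak-type maximal inequality for
  \<open>g = \<bar>f - f\<^sub>K\<bar>\<close>. As \<open>g \<ge> 0\<close>, the asymmetric sum is dominated by the sum over all injective
  tuples, which is symmetric and hence obeys Doob's inequality for reverse martingales.
\<close>

section \<open>Increasing and injective multi-indices\<close>

text \<open>The obstacle is the missing symmetry: U_n divided by its number of terms need not be a
  reverse martingale, because it sees the order of the observations. So reverse-martingale arguments
  are kept for the nonnegative remainder, where all orderings of a tuple may be added; this costs a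
  factor d!, harmless since the mean of the remainder tends to 0. The bounded part needs only second
  moments, for which order is irrelevant. The maximal inequality is proved directly by splitting at
  the last exceedance, with invariance under permutations in place of conditional expectations. The
  work is done on the product space of sequences, where permuting coordinates preserves the measure,
  and is pulled back along the law of the whole sequence. Since \<open>f\<close> may be negative, U
  need not be monotone in n: N_- and N_+ may differ, and the interpolation between squares has to
  count new tuples instead of using monotonicity.\<close>

lemma finite_incr_indices [simp]: "finite (incr_indices d n)"
  unfolding incr_indices_def by (rule finite_subset[of _ "{1..d} \<rightarrow>\<^sub>E {1..n}"]) (auto intro: finite_PiE)

lemma incr_indices_mono: "m \<le> n \<Longrightarrow> incr_indices d m \<subseteq> incr_indices d n"
  using PiE_mono[of "{1..d}" "\<lambda>_. {1..m}" "\<lambda>_. {1..n}"] by (auto simp: incr_indices_def)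

lemma incr_indices_0: "incr_indices 0 n = {\<lambda>_. undefined}"
  by (auto simp: incr_indices_def strict_mono_on_def)

lemma incr_indices_empty: "d > 0 \<Longrightarrow> incr_indices d 0 = {}"
  by (auto simp: incr_indices_def PiE_iff)

text \<open>Pascal's rule for sets of tuples: in an increasing tuple only the last entry can equal
  \<open>Suc n\<close>, and removing it leaves an increasing tuple with values up to
  \<open>n\<close>.\<close>

lemma incr_indices_Suc_Suc:
  "incr_indices (Suc d) (Suc n) =
     incr_indices (Suc d) n \<union> (\<lambda>i. i(Suc d := Suc n)) ` incr_indices d n"
  (is "?L = ?A \<union> ?B")
proof (intro Set.equalityI subsetI)
  fix i assume i: "i \<in> ?L"
  then have mono: "strict_mono_on {1..Suc d} i" and range: "i \<in> {1..Suc d} \<rightarrow>\<^sub>E {1..Suc n}"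
    by (auto simp: incr_indices_def)
  show "i \<in> ?A \<union> ?B"
  proof (cases "i (Suc d) = Suc n")
    case True
    define j where "j = i(Suc d := undefined)"
    have "i = j(Suc d := Suc n)" using True by (auto simp: j_def)
    moreover have "j \<in> incr_indices d n"
    proof -
      have "i k \<le> n" if "k \<in> {1..d}" for k
        using strict_mono_onD[OF mono, of k "Suc d"] that True by auto
      then have "j \<in> {1..d} \<rightarrow>\<^sub>E {1..n}"
        using range by (auto simp: j_def PiE_iff extensional_def)
      moreover have "strict_mono_on {1..d} j"
        using mono by (auto simp: strict_mono_on_def j_def)
      ultimately show ?thesis by (simp add: incr_indices_def)
    qed
    ultimately show ?thesis by blast
  next
    case False
    have "i k \<le> n" if "k \<in> {1..Suc d}" for k
    proof -
      have "i (Suc d) \<le> n" using range False by (auto simp: PiE_iff le_Suc_eq)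
      then show ?thesis
        using strict_mono_onD[OF mono, of k "Suc d"] that by (cases "k = Suc d") auto
    qed
    then have "i \<in> ?A" using range mono by (auto simp: incr_indices_def PiE_iff)
    then show ?thesis by blast
  qed
next
  fix i assume "i \<in> ?A \<union> ?B"
  then show "i \<in> ?L"
  proof
    assume "i \<in> ?A" then show ?thesis using incr_indices_mono[of n "Suc n" "Suc d"] by auto
  next
    assume "i \<in> ?B"
    then obtain j where j: "j \<in> incr_indices d n" "i = j(Suc d := Suc n)" by blast
    have "i \<in> {1..Suc d} \<rightarrow>\<^sub>E {1..Suc n}"
    proof (rule PiE_I)
      fix k assume "k \<in> {1..Suc d}"
      then show "i k \<in> {1..Suc n}"
        using j by (cases "k = Suc d") (auto simp: incr_indices_def PiE_iff le_Suc_eq)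
    next
      fix k assume "k \<notin> {1..Suc d}"
      then show "i k = undefined"
        using j by (auto simp: incr_indices_def PiE_iff extensional_def)
    qed
    moreover have "strict_mono_on {1..Suc d} i"
    proof (rule strict_mono_onI)
      fix r s assume rs: "r \<in> {1..Suc d}" "s \<in> {1..Suc d}" "r < s"
      have "j r < j s" if "s \<le> d"
        using rs that j by (auto simp: incr_indices_def strict_mono_on_def)
      moreover have "j r < Suc n" using rs j by (auto simp: incr_indices_def PiE_iff le_imp_less_Suc)
      ultimately show "i r < i s" using rs j by (auto simp: le_Suc_eq)
    qed
    ultimately show ?thesis by (simp add: incr_indices_def)
  qed
qed

lemma card_incr_indices: "card (incr_indices d n) = n choose d"
proof (induction n arbitrary: d)
  case 0
  then show ?case by (cases d) (auto simp: incr_indices_0 incr_indices_empty)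
next
  case (Suc n)
  show ?case
  proof (cases d)
    case 0
    then show ?thesis by (simp add: incr_indices_0)
  next
    case (Suc e)
    have "incr_indices (Suc e) n \<inter> (\<lambda>i. i(Suc e := Suc n)) ` incr_indices e n = {}"
    proof -
      have "i (Suc e) \<le> n" if "i \<in> incr_indices (Suc e) n" for i
        using that by (auto simp: incr_indices_def PiE_iff)
      then show ?thesis by fastforce
    qed
    moreover have "inj_on (\<lambda>i. i(Suc e := Suc n)) (incr_indices e n)"
    proof (rule inj_onI)
      fix i j assume ij: "i \<in> incr_indices e n" "j \<in> incr_indices e n"
        and eq: "i(Suc e := Suc n) = j(Suc e := Suc n)"
      have "i (Suc e) = j (Suc e)"
        using ij by (auto simp: incr_indices_def PiE_iff extensional_def)
      then show "i = j" using eq by (metis fun_upd_triv fun_upd_upd)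
    qed
    ultimately show ?thesis
      using Suc.IH by (simp add: Suc incr_indices_Suc_Suc card_Un_disjoint card_image)
  qed
qed

text \<open>After a shift by \<open>d\<close> this is \<open>fact_binomial_limit\<close>, up to the
  correction factor \<open>(real n / real (n + d)) ^ d\<close>, which tends to 1.\<close>

lemma binomial_over_power_tendsto:
  "(\<lambda>n. real (n choose d) / real n ^ d) \<longlonglongrightarrow> 1 / fact d"
proof (rule LIMSEQ_offset[where k = d])
  have "(\<lambda>n. real ((d + n) choose n) / real (n ^ d) * (real n / real (n + d)) ^ d)
      \<longlonglongrightarrow> 1 / fact d * 1 ^ d"
  proof (intro tendsto_mult tendsto_power fact_binomial_limit)
    show "(\<lambda>n. real n / real (n + d)) \<longlonglongrightarrow> 1"
    proof (rule Lim_transform_eventually)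
      show "(\<lambda>n. 1 / (1 + real d / real n)) \<longlonglongrightarrow> 1"
        using tendsto_divide[OF tendsto_const tendsto_add[OF tendsto_const lim_const_over_n], of 1 1 "real d"]
        by simp
      show "\<forall>\<^sub>F n in sequentially. 1 / (1 + real d / real n) = real n / real (n + d)"
        using eventually_gt_at_top[of 0] by eventually_elim (simp add: field_simps)
    qed
  qed
  moreover have "\<forall>\<^sub>F n in sequentially.
      real ((d + n) choose n) / real (n ^ d) * (real n / real (n + d)) ^ d =
      real (n + d choose d) / real (n + d) ^ d"
    using eventually_gt_at_top[of 0]
  proof eventually_elim
    fix n :: nat assume "0 < n"
    moreover have "(d + n) choose n = (n + d) choose d"
      using binomial_symmetric[of d "n + d"] by (simp add: add.commute)
    ultimately show "real ((d + n) choose n) / real (n ^ d) * (real n / real (n + d)) ^ d =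
      real (n + d choose d) / real (n + d) ^ d"
      by (simp add: power_divide)
  qed
  ultimately show "(\<lambda>n. real (n + d choose d) / real (n + d) ^ d) \<longlonglongrightarrow> 1 / fact d"
    using Lim_transform_eventually by fastforce
qed

section \<open>Injective tuples and permutations of the indices\<close>

text \<open>The closure of the increasing tuples under permutations of \<open>{1..n}\<close>: each
  increasing tuple occurs here in all its \<open>fact d\<close> orderings.\<close>

definition inj_indices :: "nat \<Rightarrow> nat \<Rightarrow> (nat \<Rightarrow> nat) set" where
  "inj_indices d n = {i \<in> {1..d} \<rightarrow>\<^sub>E {1..n}. inj_on i {1..d}}"

lemma finite_inj_indices [simp]: "finite (inj_indices d n)"
  unfolding inj_indices_def by (rule finite_subset[of _ "{1..d} \<rightarrow>\<^sub>E {1..n}"]) (auto intro: finite_PiE)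

lemma card_inj_indices_le: "card (inj_indices d n) \<le> n ^ d"
proof -
  have "card (inj_indices d n) \<le> card ({1..d} \<rightarrow>\<^sub>E {1..n})"
    unfolding inj_indices_def by (rule card_mono) (auto intro: finite_PiE)
  then show ?thesis by (simp add: card_PiE)
qed

lemma incr_indices_subset_inj_indices: "incr_indices d n \<subseteq> inj_indices d n"
  by (auto simp: incr_indices_def inj_indices_def strict_mono_on_imp_inj_on)

lemma inj_indicesD:
  assumes "i \<in> inj_indices d n"
  shows "inj_on i {1..d}" "i \<in> {1..d} \<rightarrow> {1..}" "i ` {1..d} \<subseteq> {1..n}"
  using assms by (auto simp: inj_indices_def)

text \<open>Composition with \<open>p\<close> maps the finite set \<open>inj_indices d n\<close>
  injectively into itself, hence bijectively, so it merely reorders the sum.\<close>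

lemma inj_indices_permute_sum:
  assumes "bij_betw p {1..n} {1..n}"
  shows "(\<Sum>i\<in>inj_indices d n. g (\<lambda>k\<in>{1..d}. x (p (i k)))) =
         (\<Sum>i\<in>inj_indices d n. g (\<lambda>k\<in>{1..d}. x (i k)))"
proof -
  have inj: "inj_on p {1..n}" using assms by (simp add: bij_betw_def)
  have maps: "(\<lambda>i. \<lambda>k\<in>{1..d}. p (i k)) ` inj_indices d n \<subseteq> inj_indices d n"
  proof (clarify)
    fix i assume i: "i \<in> inj_indices d n"
    have "inj_on (p \<circ> i) {1..d}"
      using inj_indicesD[OF i] inj by (intro comp_inj_on) (auto intro: inj_on_subset)
    then have "inj_on (\<lambda>k\<in>{1..d}. p (i k)) {1..d}"
      by (simp add: inj_on_restrict_eq comp_def)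
    moreover have "p (i k) \<in> {1..n}" if "k \<in> {1..d}" for k
      using bij_betwE[OF assms] inj_indicesD(3)[OF i] that by blast
    ultimately show "(\<lambda>k\<in>{1..d}. p (i k)) \<in> inj_indices d n"
      unfolding inj_indices_def by auto
  qed
  have "inj_on (\<lambda>i. \<lambda>k\<in>{1..d}. p (i k)) (inj_indices d n)"
  proof (rule inj_onI, rule ext)
    fix i j k assume ij: "i \<in> inj_indices d n" "j \<in> inj_indices d n"
      and eq: "(\<lambda>k\<in>{1..d}. p (i k)) = (\<lambda>k\<in>{1..d}. p (j k))"
    show "i k = j k"
    proof (cases "k \<in> {1..d}")
      case True
      then have "p (i k) = p (j k)" using fun_cong[OF eq, of k] by simp
      then show ?thesis using inj ij True by (auto simp: inj_indices_def PiE_iff dest: inj_onD)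
    next
      case False
      then show ?thesis using ij by (auto simp: inj_indices_def PiE_iff extensional_def)
    qed
  qed
  then have bij: "bij_betw (\<lambda>i. \<lambda>k\<in>{1..d}. p (i k)) (inj_indices d n) (inj_indices d n)"
    using endo_inj_surj[OF finite_inj_indices maps] by (simp add: bij_betw_def)
  have "(\<lambda>k\<in>{1..d}. x ((\<lambda>k\<in>{1..d}. p (i k)) k)) = (\<lambda>k\<in>{1..d}. x (p (i k)))" for i
    by auto
  then show ?thesis
    using sum.reindex_bij_betw[OF bij, of "\<lambda>i. g (\<lambda>k\<in>{1..d}. x (i k))"] by simp
qed

text \<open>The complements of \<open>{1..d}\<close> and of the range of \<open>i\<close> in
  \<open>{1..n}\<close> have equal size, so any bijection between them completes \<open>i\<close>.
  Thus every injective tuple is the image of (1, ..., d) under a permutation, which is what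
  exchangeability needs.\<close>

lemma inj_indices_extend:
  assumes i: "i \<in> inj_indices d n"
  obtains p where "p permutes {1..n}" "\<And>k. k \<in> {1..d} \<Longrightarrow> p k = i k"
proof -
  note i' = inj_indicesD[OF i]
  have ci: "card (i ` {1..d}) = d" using i' by (simp add: card_image)
  then have dn: "d \<le> n" using card_mono[OF _ i'(3)] by simp
  have "card ({1..n} - {1..d}) = card ({1..n} - i ` {1..d})"
    using i' dn ci by (simp add: card_Diff_subset)
  then obtain q where q: "bij_betw q ({1..n} - {1..d}) ({1..n} - i ` {1..d})"
    using finite_same_card_bij[of "{1..n} - {1..d}" "{1..n} - i ` {1..d}"] by auto
  have "bij_betw (\<lambda>k. if k \<in> {1..d} then i k else q k)
      ({1..d} \<union> ({1..n} - {1..d})) (i ` {1..d} \<union> ({1..n} - i ` {1..d}))"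
    using i' q by (intro bij_betw_disjoint_Un) (auto simp: bij_betw_def)
  moreover have "{1..d} \<union> ({1..n} - {1..d}) = {1..n}" using dn by auto
  moreover have "i ` {1..d} \<union> ({1..n} - i ` {1..d}) = {1..n}" using i' by auto
  ultimately have "bij_betw (\<lambda>k. if k \<in> {1..d} then i k else q k) {1..n} {1..n}" by simp
  then have "bij_betw (\<lambda>k. if k \<in> {1..n} then if k \<in> {1..d} then i k else q k else k) {1..n} {1..n}"
    by (rule bij_betw_cong[THEN iffD1, rotated]) simp
  then have "(\<lambda>k. if k \<in> {1..n} then if k \<in> {1..d} then i k else q k else k) permutes {1..n}"
    by (rule bij_imp_permutes) auto
  then show ?thesis by (rule that) (use dn in auto)
qed

section \<open>A maximal inequality for sums over injective tuples\<close>

text \<open>Otherwise the simplifier turns \<open>{1..d}\<close> into \<open>{Suc 0..d}\<close> and stored facts no longer match.\<close>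
declare One_nat_def [simp del]

lemma restrict_reindex_measurable:
  assumes "i \<in> I \<rightarrow> K"
  shows "(\<lambda>x. \<lambda>k\<in>I. x (i k)) \<in> measurable (PiM K (\<lambda>_. M)) (PiM I (\<lambda>_. M))"
  using assms by (intro measurable_restrict measurable_component_singleton) auto

definition inj_sum :: "nat \<Rightarrow> ((nat \<Rightarrow> 's) \<Rightarrow> real) \<Rightarrow> nat \<Rightarrow> (nat \<Rightarrow> 's) \<Rightarrow> real" where
  "inj_sum d g n x = (\<Sum>i\<in>inj_indices d n. g (\<lambda>k\<in>{1..d}. x (i k)))"

text \<open>A permutation of \<open>{1..n}\<close> also permutes \<open>{1..m}\<close> for each
  later \<open>m\<close>. Hence events that speak only of the sums from \<open>n\<close> onwards are
  invariant under it; this replaces the decreasing filtration of a reverse martingale.\<close>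

lemma inj_sum_permute:
  assumes "p permutes {1..n}" "n \<le> m"
  shows "inj_sum d g m (\<lambda>k\<in>{1..}. x (p k)) = inj_sum d g m x"
proof -
  have "bij_betw p {1..m} {1..m}"
    using assms by (intro permutes_imp_bij permutes_subset[OF assms(1)]) auto
  moreover have "inj_sum d g m (\<lambda>k\<in>{1..}. x (p k)) =
      (\<Sum>i\<in>inj_indices d m. g (\<lambda>k\<in>{1..d}. x (p (i k))))"
    unfolding inj_sum_def
  proof (intro sum.cong refl arg_cong[of _ _ g] restrict_ext)
    fix i k assume "i \<in> inj_indices d m" "k \<in> {1..d}"
    then have "i k \<in> {1..}" using inj_indicesD(2) by blast
    then show "(\<lambda>k\<in>{1..}. x (p k)) (i k) = x (p (i k))" by simp
  qed
  ultimately show ?thesis using inj_indices_permute_sum by (simp add: inj_sum_def)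
qed

section \<open>Exchangeability of the product coordinates and the maximal inequality\<close>

context prob_space
begin

abbreviation seq_space :: "(nat \<Rightarrow> 'a) measure" where
  "seq_space \<equiv> PiM {1..} (\<lambda>_. M)"

lemma prob_space_seq_space: "prob_space seq_space"
  by (intro prob_space_PiM prob_space_axioms)

text \<open>The source of exchangeability. With \<open>I = {1..d}\<close> it gives every injective
  tuple the law of d independent points; with \<open>I = {1..}\<close> it makes permutations of the
  coordinates measure preserving.\<close>

lemma distr_seq_space_reindex:
  assumes "inj_on i I" "i \<in> I \<rightarrow> {1..}"
  shows "distr seq_space (PiM I (\<lambda>_. M)) (\<lambda>x. \<lambda>k\<in>I. x (i k)) = PiM I (\<lambda>_. M)"
  using distr_PiM_reindex[of "{1..}" "\<lambda>_. M" i I] assms prob_space_axioms by auto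

lemma kernel_measurable [measurable]:
  assumes "g \<in> borel_measurable (PiM {1..d} (\<lambda>_. M))" "i \<in> inj_indices d n"
  shows "(\<lambda>x. g (\<lambda>k\<in>{1..d}. x (i k)) :: real) \<in> borel_measurable seq_space"
  by (rule measurable_compose[OF restrict_reindex_measurable assms(1)])
     (use inj_indicesD(2)[OF assms(2)] in simp)

lemma kernel_integral:
  fixes g :: "(nat \<Rightarrow> 'a) \<Rightarrow> real"
  assumes i: "i \<in> inj_indices d n" and g: "g \<in> borel_measurable (PiM {1..d} (\<lambda>_. M))"
  shows "(\<integral>x. g (\<lambda>k\<in>{1..d}. x (i k)) \<partial>seq_space) = (\<integral>x. g x \<partial>PiM {1..d} (\<lambda>_. M))"
    and "integrable (PiM {1..d} (\<lambda>_. M)) g \<Longrightarrow> integrable seq_space (\<lambda>x. g (\<lambda>k\<in>{1..d}. x (i k)))"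
proof -
  note i' = inj_indicesD[OF i]
  note m = restrict_reindex_measurable[OF i'(2), of M]
  note d = distr_seq_space_reindex[OF i'(1,2)]
  show "(\<integral>x. g (\<lambda>k\<in>{1..d}. x (i k)) \<partial>seq_space) = (\<integral>x. g x \<partial>PiM {1..d} (\<lambda>_. M))"
    using integral_distr[OF m g] d by simp
  show "integrable (PiM {1..d} (\<lambda>_. M)) g \<Longrightarrow> integrable seq_space (\<lambda>x. g (\<lambda>k\<in>{1..d}. x (i k)))"
    using integrable_distr_eq[OF m g] d by simp
qed

lemma seq_space_permute_integral:
  fixes h :: "(nat \<Rightarrow> 'a) \<Rightarrow> real"
  assumes p: "p permutes {1..n}" and h: "h \<in> borel_measurable seq_space"
  shows "(\<integral>x. h (\<lambda>k\<in>{1..}. x (p k)) \<partial>seq_space) = (\<integral>x. h x \<partial>seq_space)"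
proof -
  have "p permutes {1..}" using p by (rule permutes_subset) auto
  then have b: "bij_betw p {1..} {1..}" by (rule permutes_imp_bij)
  then have i: "inj_on p {1..}" "p \<in> {1..} \<rightarrow> {1..}" by (auto simp: bij_betw_def)
  show ?thesis
    using integral_distr[OF restrict_reindex_measurable[OF i(2), of M] h]
      distr_seq_space_reindex[OF i] by simp
qed

lemma inj_sum_measurable [measurable]:
  assumes "g \<in> borel_measurable (PiM {1..d} (\<lambda>_. M))"
  shows "inj_sum d g n \<in> borel_measurable seq_space"
  unfolding inj_sum_def[abs_def] using assms by (intro borel_measurable_sum kernel_measurable)

text \<open>
  Split according to the last \<open>n \<le> N\<close> at which the bound is exceeded. That event is invariant under
  permutations of the first \<open>n\<close> coordinates, so on it every injective tuple from \<open>{1..n}\<close>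
  contributes the same integral as the tuple \<open>(1, \<dots>, d)\<close>.
\<close>

lemma inj_sum_maximal_finite:
  assumes g: "integrable (PiM {1..d} (\<lambda>_. M)) g" and nonneg: "\<And>x. g x \<ge> 0"
  shows "l * measure seq_space {x\<in>space seq_space. \<exists>n\<in>{1..N}. inj_sum d g n x > l * real n ^ d}
    \<le> (\<integral>x. g x \<partial>PiM {1..d} (\<lambda>_. M))"
proof -
  interpret P: prob_space seq_space by (rule prob_space_seq_space)
  have gm [measurable]: "g \<in> borel_measurable (PiM {1..d} (\<lambda>_. M))" using g by simp
  define A where "A n = {x\<in>space seq_space. inj_sum d g n x > l * real n ^ d \<and>
    (\<forall>m\<in>{n<..N}. inj_sum d g m x \<le> l * real m ^ d)}" for n
  define G where "G x = g (\<lambda>k\<in>{1..d}. x k)" for x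
  have A [measurable]: "A n \<in> sets seq_space" for n unfolding A_def by measurable
  have id: "restrict (\<lambda>k. k) {1..d} \<in> inj_indices d d"
    by (auto simp: inj_indices_def inj_on_def)
  have G_eq: "(\<lambda>x. g (\<lambda>k\<in>{1..d}. x (restrict (\<lambda>k. k) {1..d} k))) = G"
    unfolding G_def by (intro ext arg_cong[of _ _ g] restrict_ext) auto
  have Gm [measurable]: "G \<in> borel_measurable seq_space"
    using kernel_measurable[OF gm id] unfolding G_eq .
  have Gint: "integrable seq_space G"
    using kernel_integral(2)[OF id gm g] unfolding G_eq .
  have GE: "(\<integral>x. G x \<partial>seq_space) = (\<integral>x. g x \<partial>PiM {1..d} (\<lambda>_. M))"
    using kernel_integral(1)[OF id gm] unfolding G_eq .
  have ind_int: "integrable seq_space (\<lambda>x. indicator B x * F x)"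
    if "B \<in> sets seq_space" "integrable seq_space F" for B and F :: "_ \<Rightarrow> real"
    using integrable_mult_indicator[OF that] by simp
  have exch: "(\<integral>x. indicator (A n) x * g (\<lambda>k\<in>{1..d}. x (i k)) \<partial>seq_space) =
      (\<integral>x. indicator (A n) x * G x \<partial>seq_space)" if i: "i \<in> inj_indices d n" for i n
  proof -
    obtain p where p: "p permutes {1..n}" "\<And>k. k \<in> {1..d} \<Longrightarrow> p k = i k"
      using inj_indices_extend[OF i] by blast
    have "(\<integral>x. indicator (A n) x * G x \<partial>seq_space) =
      (\<integral>x. indicator (A n) (\<lambda>k\<in>{1..}. x (p k)) * G (\<lambda>k\<in>{1..}. x (p k)) \<partial>seq_space)"
      by (rule seq_space_permute_integral[OF p(1), symmetric]) measurable
    also have "\<dots> = (\<integral>x. indicator (A n) x * g (\<lambda>k\<in>{1..d}. x (i k)) \<partial>seq_space)"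
    proof (rule Bochner_Integration.integral_cong[OF refl])
      fix x assume x: "x \<in> space seq_space"
      have "p \<in> {1..} \<rightarrow> {1..}"
        using permutes_in_image[OF permutes_subset[OF p(1), of "{1..}"]] by auto
      then have "(\<lambda>k\<in>{1..}. x (p k)) \<in> space seq_space"
        using x by (auto simp: space_PiM)
      moreover have "inj_sum d g m (\<lambda>k\<in>{1..}. x (p k)) = inj_sum d g m x" if "n \<le> m" for m
        using inj_sum_permute[OF p(1) that, of d g x] .
      ultimately have "(\<lambda>k\<in>{1..}. x (p k)) \<in> A n \<longleftrightarrow> x \<in> A n"
        using x unfolding A_def by simp
      moreover have "G (\<lambda>k\<in>{1..}. x (p k)) = g (\<lambda>k\<in>{1..d}. x (i k))"
        unfolding G_def using p(2) by (intro arg_cong[of _ _ g] restrict_ext) auto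
      ultimately show "indicator (A n) (\<lambda>k\<in>{1..}. x (p k)) * G (\<lambda>k\<in>{1..}. x (p k)) =
          indicator (A n) x * g (\<lambda>k\<in>{1..d}. x (i k))"
        by (simp add: indicator_def)
    qed
    finally show ?thesis ..
  qed
  have bound: "l * measure seq_space (A n) \<le> (\<integral>x. indicator (A n) x * G x \<partial>seq_space)"
    if n: "n \<ge> 1" for n
  proof -
    have pos: "0 \<le> (\<integral>x. indicator (A n) x * G x \<partial>seq_space)"
      by (intro integral_nonneg_AE) (auto simp: G_def nonneg)
    have "real n ^ d * (l * measure seq_space (A n)) =
        (\<integral>x. indicator (A n) x * (l * real n ^ d) \<partial>seq_space)"
      using sets.sets_into_space[OF A[of n]] by (simp add: Int_absorb2)
    also have "\<dots> \<le> (\<integral>x. (\<Sum>i\<in>inj_indices d n. indicator (A n) x * g (\<lambda>k\<in>{1..d}. x (i k))) \<partial>seq_space)"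
    proof (rule integral_mono)
      show "integrable seq_space (\<lambda>x. indicator (A n) x * (l * real n ^ d))"
        by (intro ind_int) auto
      show "integrable seq_space (\<lambda>x. \<Sum>i\<in>inj_indices d n. indicator (A n) x * g (\<lambda>k\<in>{1..d}. x (i k)))"
        by (intro Bochner_Integration.integrable_sum ind_int kernel_integral(2) g) auto
      show "indicator (A n) x * (l * real n ^ d) \<le>
          (\<Sum>i\<in>inj_indices d n. indicator (A n) x * g (\<lambda>k\<in>{1..d}. x (i k)))" for x
        by (auto simp: A_def inj_sum_def indicator_def)
    qed
    also have "\<dots> = (\<Sum>i\<in>inj_indices d n. \<integral>x. indicator (A n) x * g (\<lambda>k\<in>{1..d}. x (i k)) \<partial>seq_space)"
      by (intro Bochner_Integration.integral_sum ind_int kernel_integral(2) g) auto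
    also have "\<dots> = real (card (inj_indices d n)) * (\<integral>x. indicator (A n) x * G x \<partial>seq_space)"
      using exch by simp
    \<comment> \<open>The level is scaled by \<open>real n ^ d\<close>, a convenient upper bound for
      the number of tuples; enlarging the factor is allowed because the integral is
      nonnegative.\<close>
    also have "\<dots> \<le> real (n ^ d) * (\<integral>x. indicator (A n) x * G x \<partial>seq_space)"
      by (intro mult_right_mono pos of_nat_mono card_inj_indices_le)
    finally show ?thesis using n by simp
  qed
  have disj: "disjoint_family_on A {1..N}"
    unfolding disjoint_family_on_def
  proof (intro ballI impI)
    fix m n assume mn: "m \<in> {1..N}" "n \<in> {1..N}" "m \<noteq> n"
    have "A m \<inter> A n = {}" if "m < n" "n \<in> {1..N}" for m n
    proof -
      have False if x: "x \<in> A m" "x \<in> A n" for x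
      proof -
        have "inj_sum d g n x \<le> l * real n ^ d"
          using x(1) \<open>m < n\<close> \<open>n \<in> {1..N}\<close> by (simp add: A_def)
        then show False using x(2) by (simp add: A_def)
      qed
      then show ?thesis by blast
    qed
    then show "A m \<inter> A n = {}" using mn by (metis Int_commute nat_neq_iff)
  qed
  have un: "{x\<in>space seq_space. \<exists>n\<in>{1..N}. inj_sum d g n x > l * real n ^ d} = (\<Union>n\<in>{1..N}. A n)"
    (is "?E = _")
  proof (intro Set.equalityI subsetI)
    fix x assume x: "x \<in> ?E"
    define T where "T = {n\<in>{1..N}. inj_sum d g n x > l * real n ^ d}"
    have T: "finite T" "T \<noteq> {}" using x by (auto simp: T_def)
    have "Max T \<in> T" using T by (rule Max_in)
    moreover have "\<forall>m>Max T. m \<notin> T" using T by (meson Max_ge leD)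
    ultimately obtain q where q: "q \<in> T" "\<forall>m>q. m \<notin> T" by blast
    have "inj_sum d g m x \<le> l * real m ^ d" if "m \<in> {q<..N}" for m
    proof -
      have "m \<in> {1..N}" "m \<notin> T" using that q by auto
      then show ?thesis by (simp add: T_def)
    qed
    then have "x \<in> A q" "q \<in> {1..N}" using x q(1) by (simp_all add: T_def A_def)
    then show "x \<in> (\<Union>n\<in>{1..N}. A n)" by blast
  qed (auto simp: A_def)
  have "l * measure seq_space ?E = (\<Sum>n\<in>{1..N}. l * measure seq_space (A n))"
    unfolding un using disj by (subst P.finite_measure_finite_Union) (auto simp: sum_distrib_left)
  also have "\<dots> \<le> (\<Sum>n\<in>{1..N}. \<integral>x. indicator (A n) x * G x \<partial>seq_space)"
    by (intro sum_mono bound) auto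
  also have "\<dots> = (\<integral>x. (\<Sum>n\<in>{1..N}. indicator (A n) x * G x) \<partial>seq_space)"
    by (intro Bochner_Integration.integral_sum[symmetric] ind_int Gint) auto
  \<comment> \<open>A point has at most one last exceedance, so the indicators add up to at most 1.
    This is why the bound does not grow with \<open>N\<close>.\<close>
  also have "\<dots> \<le> (\<integral>x. G x \<partial>seq_space)"
  proof (rule integral_mono)
    show "integrable seq_space (\<lambda>x. \<Sum>n\<in>{1..N}. indicator (A n) x * G x)"
      by (intro Bochner_Integration.integrable_sum ind_int Gint) auto
    fix x
    have "(\<Sum>n\<in>{1..N}. indicator (A n) x * G x) = indicator (\<Union>n\<in>{1..N}. A n) x * G x"
      by (simp only: indicator_UN_disjoint[OF _ disj] sum_distrib_right finite_atLeastAtMost)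
    moreover have "G x \<ge> 0" by (simp add: G_def nonneg)
    ultimately show "(\<Sum>n\<in>{1..N}. indicator (A n) x * G x) \<le> G x"
      by (simp only: indicator_times_eq_if) simp
  qed (rule Gint)
  finally show ?thesis using GE by simp
qed

text \<open>Among infinitely many \<open>n\<close> a last exceedance need not exist, so the
  decomposition is made for each finite \<open>N\<close>; its bound is independent of
  \<open>N\<close> and survives continuity from below.\<close>

lemma inj_sum_maximal:
  assumes g: "integrable (PiM {1..d} (\<lambda>_. M)) g" and nonneg: "\<And>x. g x \<ge> 0"
  shows "l * measure seq_space {x\<in>space seq_space. \<exists>n\<ge>1. inj_sum d g n x > l * real n ^ d}
    \<le> (\<integral>x. g x \<partial>PiM {1..d} (\<lambda>_. M))"
proof -
  interpret P: prob_space seq_space by (rule prob_space_seq_space)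
  have gm [measurable]: "g \<in> borel_measurable (PiM {1..d} (\<lambda>_. M))" using g by simp
  define E where "E N = {x\<in>space seq_space. \<exists>n\<in>{1..N}. inj_sum d g n x > l * real n ^ d}" for N
  have E [measurable]: "E N \<in> sets seq_space" for N unfolding E_def by measurable
  have "E N \<subseteq> E N'" if "N \<le> N'" for N N'
    using that by (auto simp: E_def intro: order_trans)
  then have "(\<lambda>N. measure seq_space (E N)) \<longlonglongrightarrow> measure seq_space (\<Union>N. E N)"
    by (intro P.finite_Lim_measure_incseq) (use E in \<open>auto simp: incseq_def\<close>)
  then have "(\<lambda>N. l * measure seq_space (E N)) \<longlonglongrightarrow> l * measure seq_space (\<Union>N. E N)"
    by (rule tendsto_mult_left)
  moreover have "(\<Union>N. E N) = {x\<in>space seq_space. \<exists>n\<ge>1. inj_sum d g n x > l * real n ^ d}"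
    by (fastforce simp: E_def)
  moreover have "l * measure seq_space (E N) \<le> (\<integral>x. g x \<partial>PiM {1..d} (\<lambda>_. M))" for N
    unfolding E_def by (rule inj_sum_maximal_finite[OF assms])
  ultimately show ?thesis
    using LIMSEQ_le_const2[where X = "\<lambda>N. l * measure seq_space (E N)"] by auto
qed

end

section \<open>The strong law for U-statistics\<close>

text \<open>By Tonelli the series of the \<open>V k\<close> has finite mean, so it converges almost
  surely and its terms vanish. Applied to squared normalised sums, this replaces Chebyshev with
  Borel-Cantelli.\<close>

lemma AE_tendsto_zero_if_summable_integral:
  fixes V :: "nat \<Rightarrow> 'a \<Rightarrow> real"
  assumes int: "\<And>k. integrable M (V k)" and nonneg: "\<And>k x. V k x \<ge> 0"
    and sum: "summable (\<lambda>k. \<integral>x. V k x \<partial>M)"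
  shows "AE x in M. (\<lambda>k. V k x) \<longlonglongrightarrow> 0"
proof -
  have [measurable]: "V k \<in> borel_measurable M" for k using int[of k] by simp
  have "(\<integral>\<^sup>+x. (\<Sum>k. ennreal (V k x)) \<partial>M) = (\<Sum>k. \<integral>\<^sup>+x. ennreal (V k x) \<partial>M)"
    by (rule nn_integral_suminf) auto
  also have "\<dots> = (\<Sum>k. ennreal (\<integral>x. V k x \<partial>M))"
    using int nonneg by (simp add: nn_integral_eq_integral)
  also have "\<dots> = ennreal (\<Sum>k. \<integral>x. V k x \<partial>M)"
    using sum nonneg by (intro suminf_ennreal2 Bochner_Integration.integral_nonneg) auto
  also have "\<dots> \<noteq> \<infinity>" by simp
  finally have "AE x in M. (\<Sum>k. ennreal (V k x)) \<noteq> \<infinity>"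
    by (intro nn_integral_PInf_AE) auto
  then show ?thesis
  proof eventually_elim
    case (elim x)
    then have "summable (\<lambda>k. V k x)"
      using nonneg by (intro summable_suminf_not_top) (auto simp: infinity_ennreal_def)
    then show ?case by (rule summable_LIMSEQ_zero)
  qed
qed

text \<open>A coincidence \<open>i a = j b\<close> determines one entry of \<open>j\<close>, leaving
  \<open>d + (d - 1)\<close> free entries in the pair. The factor \<open>d\<^sup>2\<close> counts
  the positions \<open>(a, b)\<close>; monotonicity is dropped in the count.\<close>

lemma card_meeting_pairs_le:
  "card {(i, j) \<in> incr_indices d n \<times> incr_indices d n. i ` {1..d} \<inter> j ` {1..d} \<noteq> {}}
     \<le> d\<^sup>2 * n ^ (d + (d - 1))"
proof -
  define F where "F = {1..d} \<rightarrow>\<^sub>E {1..n}"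
  define B where "B a b = (SIGMA i:F. PiE {1..d} (\<lambda>k. if k = b then {i a} else {1..n}))"
    for a b :: nat
  have F: "finite F" "card F = n ^ d" by (auto simp: F_def card_PiE intro: finite_PiE)
  have B: "finite (B a b)" for a b
    unfolding B_def by (intro finite_SigmaI F finite_PiE) auto
  have cB: "card (B a b) = n ^ (d + (d - 1))" if "b \<in> {1..d}" for a b
  proof -
    have "card (PiE {1..d} (\<lambda>k. if k = b then {c} else {1..n})) = n ^ (d - 1)" for c
    proof -
      have "card (PiE {1..d} (\<lambda>k. if k = b then {c} else {1..n})) =
          (\<Prod>k\<in>{1..d}. card (if k = b then {c} else {1..n}))"
        by (rule card_PiE) simp
      also have "\<dots> = (\<Prod>k\<in>{1..d} - {b}. card (if k = b then {c} else {1..n}))"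
        using that by (subst prod.remove[of _ b]) auto
      also have "\<dots> = (\<Prod>k\<in>{1..d} - {b}. n)" by (rule prod.cong) auto
      finally show ?thesis using that by simp
    qed
    then show ?thesis
      unfolding B_def by (subst card_SigmaI) (auto simp: F power_add intro: finite_PiE)
  qed
  have "{(i, j) \<in> incr_indices d n \<times> incr_indices d n. i ` {1..d} \<inter> j ` {1..d} \<noteq> {}}
      \<subseteq> (\<Union>a\<in>{1..d}. \<Union>b\<in>{1..d}. B a b)"
  proof clarify
    fix i j assume ij: "i \<in> incr_indices d n" "j \<in> incr_indices d n"
      and "i ` {1..d} \<inter> j ` {1..d} \<noteq> {}"
    then obtain a b where ab: "a \<in> {1..d}" "b \<in> {1..d}" "i a = j b" by blast
    have "i \<in> F" using ij by (simp add: F_def incr_indices_def)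
    moreover have "j \<in> PiE {1..d} (\<lambda>k. if k = b then {i a} else {1..n})"
      using ij(2) ab by (auto simp: incr_indices_def PiE_iff)
    ultimately have "(i, j) \<in> B a b" by (simp add: B_def)
    then show "(i, j) \<in> (\<Union>a\<in>{1..d}. \<Union>b\<in>{1..d}. B a b)" using ab by blast
  qed
  then have "card {(i, j) \<in> incr_indices d n \<times> incr_indices d n. i ` {1..d} \<inter> j ` {1..d} \<noteq> {}}
      \<le> card (\<Union>a\<in>{1..d}. \<Union>b\<in>{1..d}. B a b)"
    by (intro card_mono) (auto simp: B)
  also have "\<dots> \<le> (\<Sum>a\<in>{1..d}. card (\<Union>b\<in>{1..d}. B a b))" by (rule card_UN_le) simp
  also have "\<dots> \<le> (\<Sum>a\<in>{1..d}. \<Sum>b\<in>{1..d}. card (B a b))" by (intro sum_mono card_UN_le) simp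
  also have "\<dots> = (\<Sum>a\<in>{1..d}. \<Sum>b\<in>{1..d}. n ^ (d + (d - 1)))" by (intro sum.cong refl cB)
  also have "\<dots> = d\<^sup>2 * n ^ (d + (d - 1))" by (simp only: sum_constant) (simp add: power2_eq_square)
  finally show ?thesis .
qed

text \<open>Compare \<open>n\<close> with the largest square \<open>m n\<close> below it. As
  \<open>m n / n\<close> tends to 1, both binomials divided by \<open>real n ^ d\<close> have the
  limit \<open>1 / fact d\<close>, so the increment bound vanishes after normalisation.\<close>

lemma tendsto_zero_from_squares:
  fixes u :: "nat \<Rightarrow> real"
  assumes incr: "\<And>m n. m \<le> n \<Longrightarrow> \<bar>u n - u m\<bar> \<le> K * (real (n choose d) - real (m choose d))"
    and squares: "(\<lambda>k. u (k\<^sup>2) / real (k\<^sup>2) ^ d) \<longlonglongrightarrow> 0"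
  shows "(\<lambda>n. u n / real n ^ d) \<longlonglongrightarrow> 0"
proof -
  define s where "s = floor_sqrt"
  define m where "m n = (s n)\<^sup>2" for n
  have s_lim: "filterlim s at_top sequentially"
    unfolding filterlim_at_top s_def le_floor_sqrt_iff using eventually_ge_at_top by blast
  then have m_lim: "filterlim m at_top sequentially"
    unfolding m_def by (intro filterlim_compose[OF _ s_lim, of "\<lambda>k. k\<^sup>2"]
        filterlim_at_top_mono[OF filterlim_ident]) (auto simp: power2_eq_square)
  have m_le: "m n \<le> n" for n by (simp add: m_def s_def)
  have m_pos: "m n > 0" if "n > 0" for n using that by (simp add: m_def s_def)
  have ratio: "(\<lambda>n. real (m n) / real n) \<longlonglongrightarrow> 1"
  proof (rule tendsto_sandwich[of "\<lambda>n. (real (s n) / real (Suc (s n)))\<^sup>2" _ _ "\<lambda>_. 1"])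
    show "(\<lambda>n. (real (s n) / real (Suc (s n)))\<^sup>2) \<longlonglongrightarrow> 1"
      using tendsto_power[OF filterlim_compose[OF LIMSEQ_n_over_Suc_n s_lim], of 2] by simp
    show "\<forall>\<^sub>F n in sequentially. (real (s n) / real (Suc (s n)))\<^sup>2 \<le> real (m n) / real n"
      using eventually_gt_at_top[of 0]
    proof eventually_elim
      case (elim n)
      \<comment> \<open>The next square exceeds \<open>n\<close>, so \<open>m n / n\<close> is at
        least the ratio of two consecutive squares.\<close>
      have "real n \<le> real ((Suc (s n))\<^sup>2)"
        using Suc_floor_sqrt_power2_gt[of n] unfolding s_def by (intro of_nat_mono) simp
      then show ?case using elim
        by (simp add: power_divide m_def) (intro divide_left_mono, auto)
    qed
    show "\<forall>\<^sub>F n in sequentially. real (m n) / real n \<le> 1"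
      using eventually_gt_at_top[of 0] by eventually_elim (simp add: m_le)
  qed simp
  have c: "(\<lambda>n. real (m n choose d) / real n ^ d) \<longlonglongrightarrow> 1 / fact d"
  proof (rule Lim_transform_eventually)
    show "(\<lambda>n. real (m n choose d) / real (m n) ^ d * (real (m n) / real n) ^ d) \<longlonglongrightarrow> 1 / fact d"
      using tendsto_mult[OF filterlim_compose[OF binomial_over_power_tendsto m_lim] tendsto_power[OF ratio]]
      by simp
    show "\<forall>\<^sub>F n in sequentially. real (m n choose d) / real (m n) ^ d * (real (m n) / real n) ^ d
        = real (m n choose d) / real n ^ d"
      using eventually_gt_at_top[of 0] by eventually_elim (use m_pos in \<open>simp add: power_divide\<close>)
  qed
  have "(\<lambda>n. \<bar>u (m n) / real (m n) ^ d\<bar> +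
      K * (real (n choose d) / real n ^ d - real (m n choose d) / real n ^ d))
      \<longlonglongrightarrow> \<bar>0\<bar> + K * (1 / fact d - 1 / fact d)"
    unfolding m_def
    by (intro tendsto_add tendsto_rabs filterlim_compose[OF squares s_lim] tendsto_mult tendsto_const
        tendsto_diff binomial_over_power_tendsto c[unfolded m_def])
  then have lim: "(\<lambda>n. \<bar>u (m n) / real (m n) ^ d\<bar> +
      K * (real (n choose d) / real n ^ d - real (m n choose d) / real n ^ d)) \<longlonglongrightarrow> 0" by simp
  show ?thesis
  proof (rule Lim_null_comparison[OF _ lim], use eventually_gt_at_top[of 0] in eventually_elim)
    case (elim n)
    have "\<bar>u n\<bar> \<le> \<bar>u (m n)\<bar> + K * (real (n choose d) - real (m n choose d))"
      using incr[OF m_le[of n]] by linarith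
    then have "\<bar>u n\<bar> / real n ^ d \<le>
        \<bar>u (m n)\<bar> / real n ^ d + K * (real (n choose d) / real n ^ d - real (m n choose d) / real n ^ d)"
      using elim by (simp add: field_simps)
    also have "\<bar>u (m n)\<bar> / real n ^ d \<le> \<bar>u (m n)\<bar> / real (m n) ^ d"
      using m_pos[OF elim] m_le[of n] by (intro divide_left_mono power_mono) auto
    finally show ?case by simp
  qed
qed

section \<open>Bounded kernels: second moments and the strong law\<close>

context prob_space
begin

abbreviation coord_U :: "nat \<Rightarrow> ((nat \<Rightarrow> 'a) \<Rightarrow> real) \<Rightarrow> nat \<Rightarrow> (nat \<Rightarrow> 'a) \<Rightarrow> real" where
  "coord_U d g \<equiv> U_stat d g (\<lambda>k x. x k)"

lemma seq_space_indep_vars: "prob_space.indep_vars seq_space (\<lambda>_. M) (\<lambda>k x. x k) {1..}"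
proof -
  interpret P: prob_space seq_space by (rule prob_space_seq_space)
  have c: "distr seq_space M (\<lambda>x. x k) = M" if "k \<in> {1..}" for k
    using distr_PiM_component[of "{1..}" "\<lambda>_. M" k] that prob_space_axioms by auto
  have "distr seq_space seq_space (\<lambda>x. \<lambda>k\<in>{1..}. x k) = seq_space"
    using distr_seq_space_reindex[of "\<lambda>k. k" "{1..}"] by simp
  also have "\<dots> = PiM {1..} (\<lambda>k. distr seq_space M (\<lambda>x. x k))"
    using c by (intro PiM_cong) auto
  finally show ?thesis
    by (subst P.indep_vars_iff_distr_eq_PiM') auto
qed

text \<open>Each factor reads only the coordinates in the range of its own tuple. These are disjoint
  blocks of independent coordinates, so the integral factorises.\<close>

lemma disjoint_kernel_integral:
  fixes g :: "(nat \<Rightarrow> 'a) \<Rightarrow> real"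
  assumes i: "i \<in> inj_indices d n" and j: "j \<in> inj_indices d n"
    and disj: "i ` {1..d} \<inter> j ` {1..d} = {}"
    and g: "integrable (PiM {1..d} (\<lambda>_. M)) g"
  shows "(\<integral>x. g (\<lambda>k\<in>{1..d}. x (i k)) * g (\<lambda>k\<in>{1..d}. x (j k)) \<partial>seq_space) =
    (\<integral>x. g x \<partial>PiM {1..d} (\<lambda>_. M))\<^sup>2"
proof -
  interpret P: prob_space seq_space by (rule prob_space_seq_space)
  have gm: "g \<in> borel_measurable (PiM {1..d} (\<lambda>_. M))" using g by simp
  define G where "G i = (\<lambda>x. g (\<lambda>k\<in>{1..d}. x (i k)))" for i :: "nat \<Rightarrow> nat"
  have G: "G i \<in> borel_measurable (PiM (i ` {1..d}) (\<lambda>_. M))" for i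
    unfolding G_def
    by (rule measurable_compose[OF restrict_reindex_measurable gm]) auto
  have "P.indep_var (PiM (i ` {1..d}) (\<lambda>_. M)) (\<lambda>x. restrict (\<lambda>k. x k) (i ` {1..d}))
        (PiM (j ` {1..d}) (\<lambda>_. M)) (\<lambda>x. restrict (\<lambda>k. x k) (j ` {1..d}))"
    using inj_indicesD[OF i] inj_indicesD[OF j]
    by (intro P.indep_var_restrict[OF seq_space_indep_vars disj]) auto
  from P.indep_var_compose[OF this G G]
  have "P.indep_var borel (G i \<circ> (\<lambda>x. restrict x (i ` {1..d}))) borel (G j \<circ> (\<lambda>x. restrict x (j ` {1..d})))"
    by simp
  moreover have "G i \<circ> (\<lambda>x. restrict x (i ` {1..d})) = G i" for i
    unfolding G_def by (intro ext) (auto intro!: arg_cong[of _ _ g])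
  ultimately have "P.indep_var borel (G i) borel (G j)" by simp
  moreover have "integrable seq_space (G i)" "integrable seq_space (G j)"
    unfolding G_def by (rule kernel_integral(2)[OF i gm g], rule kernel_integral(2)[OF j gm g])
  ultimately have "(\<integral>x. G i x * G j x \<partial>seq_space) = (\<integral>x. G i x \<partial>seq_space) * (\<integral>x. G j x \<partial>seq_space)"
    by (rule P.indep_var_lebesgue_integral)
  then show ?thesis
    using kernel_integral(1)[OF i gm] kernel_integral(1)[OF j gm]
    by (simp add: G_def power2_eq_square)
qed

text \<open>Expand the square into pairs of tuples. Disjoint pairs contribute the squared mean,
  which is 0 by centring; each pair that meets contributes at most \<open>K\<^sup>2\<close>, and
  such pairs lack one degree of freedom.\<close>

lemma coord_U_second_moment:
  assumes g: "g \<in> borel_measurable (PiM {1..d} (\<lambda>_. M))" and bounded: "\<And>x. \<bar>g x\<bar> \<le> K"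
    and centred: "(\<integral>x. g x \<partial>PiM {1..d} (\<lambda>_. M)) = 0"
  shows "integrable seq_space (\<lambda>x. (coord_U d g n x)\<^sup>2)"
    and "(\<integral>x. (coord_U d g n x)\<^sup>2 \<partial>seq_space) \<le> K\<^sup>2 * real (d\<^sup>2 * n ^ (d + (d - 1)))"
proof -
  interpret P: prob_space seq_space by (rule prob_space_seq_space)
  interpret Q: prob_space "PiM {1..d} (\<lambda>_. M)" by (intro prob_space_PiM prob_space_axioms)
  define I where "I = incr_indices d n"
  define G where "G i = (\<lambda>x. g (\<lambda>k\<in>{1..d}. x (i k)))" for i :: "nat \<Rightarrow> nat"
  define C where "C = {(i, j) \<in> I \<times> I. i ` {1..d} \<inter> j ` {1..d} \<noteq> {}}"
  have K: "K \<ge> 0" using bounded[of undefined] by linarith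
  have II: "i \<in> inj_indices d n" if "i \<in> I" for i
    using that incr_indices_subset_inj_indices by (auto simp: I_def)
  have gint: "integrable (PiM {1..d} (\<lambda>_. M)) g"
    by (rule Q.integrable_const_bound[of _ K]) (use g bounded in auto)
  have Gm: "G i \<in> borel_measurable seq_space" if "i \<in> I" for i
    unfolding G_def by (rule kernel_measurable[OF g II[OF that]])
  have prod_le: "\<bar>G i x * G j x\<bar> \<le> K\<^sup>2" for i j x
    unfolding abs_mult power2_eq_square G_def by (intro mult_mono bounded K) auto
  have GGint: "integrable seq_space (\<lambda>x. G i x * G j x)" if "i \<in> I" "j \<in> I" for i j
    by (rule P.integrable_const_bound[of _ "K\<^sup>2"]) (use Gm that prod_le in auto)
  have sq: "(\<lambda>x. (coord_U d g n x)\<^sup>2) = (\<lambda>x. \<Sum>(i, j)\<in>I \<times> I. G i x * G j x)"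
    by (simp add: U_stat_def power2_eq_square sum_product sum.cartesian_product I_def G_def)
  show int: "integrable seq_space (\<lambda>x. (coord_U d g n x)\<^sup>2)"
    unfolding sq by (intro Bochner_Integration.integrable_sum) (use GGint in auto)
  have "(\<integral>x. (coord_U d g n x)\<^sup>2 \<partial>seq_space) = (\<Sum>(i, j)\<in>I \<times> I. \<integral>x. G i x * G j x \<partial>seq_space)"
    unfolding sq using GGint
    by (subst Bochner_Integration.integral_sum) (auto simp: case_prod_beta intro!: sum.cong)
  also have "\<dots> = (\<Sum>(i, j)\<in>C. \<integral>x. G i x * G j x \<partial>seq_space)"
  proof (rule sum.mono_neutral_right)
    show "finite (I \<times> I)" by (simp add: I_def)
    show "C \<subseteq> I \<times> I" by (auto simp: C_def)
    show "\<forall>p\<in>I \<times> I - C. (case p of (i, j) \<Rightarrow> \<integral>x. G i x * G j x \<partial>seq_space) = 0"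
      using disjoint_kernel_integral[OF II II _ gint] centred by (auto simp: C_def G_def)
  qed
  also have "\<dots> \<le> (\<Sum>p\<in>C. K\<^sup>2)"
  proof (rule sum_mono, clarify)
    fix i j assume "(i, j) \<in> C"
    then have "i \<in> I" "j \<in> I" by (auto simp: C_def)
    then have "(\<integral>x. G i x * G j x \<partial>seq_space) \<le> (\<integral>x. K\<^sup>2 \<partial>seq_space)"
      by (intro integral_mono GGint abs_le_D1[OF prod_le]) auto
    then show "(\<integral>x. G i x * G j x \<partial>seq_space) \<le> K\<^sup>2" by (simp add: P.prob_space)
  qed
  also have "\<dots> = K\<^sup>2 * real (card C)" by simp
  also have "\<dots> \<le> K\<^sup>2 * real (d\<^sup>2 * n ^ (d + (d - 1)))"
    unfolding C_def I_def by (intro mult_left_mono of_nat_mono card_meeting_pairs_le) auto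
  finally show "(\<integral>x. (coord_U d g n x)\<^sup>2 \<partial>seq_space) \<le> K\<^sup>2 * real (d\<^sup>2 * n ^ (d + (d - 1)))" .
qed

text \<open>The normalised second moment at \<open>n\<close> is of order 1/n, which is not summable;
  at \<open>n = k\<^sup>2\<close> it becomes the summable order 1/k^2. Boundedness is used again for
  the increments between squares, since each new tuple adds at most \<open>K\<close>.\<close>

lemma slln_bounded_centred:
  assumes g: "g \<in> borel_measurable (PiM {1..d} (\<lambda>_. M))" and bounded: "\<And>x. \<bar>g x\<bar> \<le> K"
    and centred: "(\<integral>x. g x \<partial>PiM {1..d} (\<lambda>_. M)) = 0" and d: "d \<ge> 1"
  shows "AE x in seq_space. (\<lambda>n. coord_U d g n x / real n ^ d) \<longlonglongrightarrow> 0"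
proof -
  define V where "V k x = (coord_U d g (k\<^sup>2) x / real (k\<^sup>2) ^ d)\<^sup>2" for k x
  have Vint: "integrable seq_space (V k)" for k
    using coord_U_second_moment(1)[OF g bounded centred, of "k\<^sup>2"]
    unfolding V_def[abs_def] power_divide by (rule integrable_divide_zero)
  have VE: "norm (\<integral>x. V k x \<partial>seq_space) \<le> K\<^sup>2 * real (d\<^sup>2) * inverse (real k ^ 2)" for k
  proof (cases "k = 0")
    case True
    \<comment> \<open>At \<open>k = 0\<close> both sides are 0 through division by zero, as
      \<open>d \<ge> 1\<close> makes the denominator vanish.\<close>
    then show ?thesis using d by (simp add: V_def power_0_left)
  next
    case False
    obtain e where e: "d = Suc e" using d by (cases d) auto
    have "(\<integral>x. V k x \<partial>seq_space) = (\<integral>x. (coord_U d g (k\<^sup>2) x)\<^sup>2 \<partial>seq_space) / (real (k\<^sup>2) ^ d)\<^sup>2"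
      unfolding V_def power_divide by simp
    also have "\<dots> \<le> K\<^sup>2 * real (d\<^sup>2 * (k\<^sup>2) ^ (d + (d - 1))) / (real (k\<^sup>2) ^ d)\<^sup>2"
      by (intro divide_right_mono coord_U_second_moment(2)[OF g bounded centred]) auto
    also have "\<dots> = K\<^sup>2 * real (d\<^sup>2) * inverse (real k ^ 2)"
    proof -
      have "(real (k\<^sup>2) ^ d)\<^sup>2 = real (k\<^sup>2) ^ (d + (d - 1)) * real k ^ 2"
        by (simp add: e power2_eq_square power_add)
      then show ?thesis using False by (simp add: field_simps)
    qed
    finally show ?thesis by (simp add: V_def)
  qed
  have "summable (\<lambda>k. K\<^sup>2 * real (d\<^sup>2) * inverse (real k ^ 2))"
    by (intro summable_mult inverse_power_summable) simp
  then have "summable (\<lambda>k. \<integral>x. V k x \<partial>seq_space)"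
    by (rule summable_comparison_test') (rule VE)
  then have "AE x in seq_space. (\<lambda>k. V k x) \<longlonglongrightarrow> 0"
    by (intro AE_tendsto_zero_if_summable_integral Vint) (simp add: V_def)
  then show ?thesis
  proof eventually_elim
    case (elim x)
    have "(\<lambda>k. coord_U d g (k\<^sup>2) x / real (k\<^sup>2) ^ d) \<longlonglongrightarrow> 0"
    proof -
      have "(\<lambda>k. \<bar>coord_U d g (k\<^sup>2) x / real (k\<^sup>2) ^ d\<bar>) \<longlonglongrightarrow> 0"
        using tendsto_real_sqrt[OF elim] unfolding V_def real_sqrt_abs by simp
      then show ?thesis by (rule tendsto_rabs_zero_cancel)
    qed
    moreover have "\<bar>coord_U d g n x - coord_U d g m x\<bar> \<le> K * (real (n choose d) - real (m choose d))"
      if "m \<le> n" for m n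
    proof -
      have sub: "incr_indices d m \<subseteq> incr_indices d n" by (rule incr_indices_mono[OF that])
      have "coord_U d g n x - coord_U d g m x =
          (\<Sum>i\<in>incr_indices d n - incr_indices d m. g (\<lambda>k\<in>{1..d}. x (i k)))"
        using sub by (simp add: U_stat_def sum_diff)
      also have "\<bar>\<dots>\<bar> \<le> (\<Sum>i\<in>incr_indices d n - incr_indices d m. K)"
        by (rule order_trans[OF sum_abs]) (intro sum_mono bounded)
      also have "\<dots> = K * (real (n choose d) - real (m choose d))"
        using sub card_mono[OF finite_incr_indices sub]
        by (simp add: card_Diff_subset card_incr_indices of_nat_diff)
      finally show ?thesis .
    qed
    ultimately show ?case by (intro tendsto_zero_from_squares)
  qed
qed

text \<open>Subtracting the mean \<open>c\<close> from the kernel subtracts exactly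
  \<open>c * real (n choose d)\<close> from the sum; this term produces the limit with its factor
  \<open>1 / fact d\<close>.\<close>

lemma slln_bounded:
  assumes g: "g \<in> borel_measurable (PiM {1..d} (\<lambda>_. M))" and bounded: "\<And>x. \<bar>g x\<bar> \<le> K" and d: "d \<ge> 1"
  shows "AE x in seq_space.
    (\<lambda>n. coord_U d g n x / real n ^ d) \<longlonglongrightarrow> (\<integral>x. g x \<partial>PiM {1..d} (\<lambda>_. M)) / fact d"
proof -
  interpret Q: prob_space "PiM {1..d} (\<lambda>_. M)" by (intro prob_space_PiM prob_space_axioms)
  define c where "c = (\<integral>x. g x \<partial>PiM {1..d} (\<lambda>_. M))"
  have gint: "integrable (PiM {1..d} (\<lambda>_. M)) g"
    by (rule Q.integrable_const_bound[of _ K]) (use g bounded in auto)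
  have "AE x in seq_space. (\<lambda>n. coord_U d (\<lambda>y. g y - c) n x / real n ^ d) \<longlonglongrightarrow> 0"
  proof (rule slln_bounded_centred[OF _ _ _ d])
    show "(\<lambda>y. g y - c) \<in> borel_measurable (PiM {1..d} (\<lambda>_. M))" using g by measurable
    show "\<bar>g y - c\<bar> \<le> K + \<bar>c\<bar>" for y using bounded[of y] by linarith
    show "(\<integral>y. g y - c \<partial>PiM {1..d} (\<lambda>_. M)) = 0"
      using gint by (simp add: c_def Q.prob_space)
  qed
  then show ?thesis
  proof eventually_elim
    case (elim x)
    have "(\<lambda>n. coord_U d (\<lambda>y. g y - c) n x / real n ^ d + c * (real (n choose d) / real n ^ d))
        \<longlonglongrightarrow> 0 + c * (1 / fact d)"
      by (intro tendsto_add elim tendsto_mult tendsto_const binomial_over_power_tendsto)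
    moreover have "coord_U d (\<lambda>y. g y - c) n x / real n ^ d + c * (real (n choose d) / real n ^ d) =
        coord_U d g n x / real n ^ d" for n
      by (simp add: U_stat_def sum_subtractf card_incr_indices diff_divide_distrib)
    ultimately show ?case by (simp add: c_def)
  qed
qed

section \<open>Truncation of integrable kernels\<close>

text \<open>The error is split into the remainder sum, the fluctuation of the truncated sum and the
  difference of the means. The first and third are bounded through \<open>K\<close> alone, uniformly
  in \<open>n\<close>, so \<open>K\<close> can be fixed before \<open>n\<close> grows.\<close>

lemma slln_coord_U:
  assumes f: "integrable (PiM {1..d} (\<lambda>_. M)) f" and d: "d \<ge> 1"
  shows "AE x in seq_space.
    (\<lambda>n. coord_U d f n x / real n ^ d) \<longlonglongrightarrow> (\<integral>x. f x \<partial>PiM {1..d} (\<lambda>_. M)) / fact d"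
proof -
  interpret P: prob_space seq_space by (rule prob_space_seq_space)
  define Q where "Q = PiM {1..d} (\<lambda>_. M)"
  have fQ: "integrable Q f" and [measurable]: "f \<in> borel_measurable Q"
    using f by (auto simp: Q_def)
  define t where "t K y = (if \<bar>f y\<bar> \<le> real K then f y else 0)" for K y
  define r where "r K y = \<bar>f y - t K y\<bar>" for K y
  have [measurable]: "t K \<in> borel_measurable Q" "r K \<in> borel_measurable Q" for K
    unfolding t_def[abs_def] r_def[abs_def] by measurable
  have t_int: "integrable Q (t K)" and r_int: "integrable Q (r K)" for K
    by (rule Bochner_Integration.integrable_bound[OF fQ]; auto simp: t_def r_def)+
  have pointwise: "(\<lambda>K. r K y) \<longlonglongrightarrow> 0" for y
  proof (rule tendsto_eventually)
    obtain K0 :: nat where "\<bar>f y\<bar> \<le> real K0" using real_arch_simple by blast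
    then show "\<forall>\<^sub>F K in sequentially. r K y = 0"
      unfolding r_def t_def by (intro eventually_sequentiallyI[of K0]) auto
  qed
  have r_lim: "(\<lambda>K. \<integral>y. r K y \<partial>Q) \<longlonglongrightarrow> 0"
  proof -
    have "(\<lambda>K. \<integral>y. r K y \<partial>Q) \<longlonglongrightarrow> (\<integral>y. 0 \<partial>Q)"
      by (rule integral_dominated_convergence[where w = "\<lambda>y. \<bar>f y\<bar>"])
        (use fQ pointwise in \<open>auto simp: r_def t_def\<close>)
    then show ?thesis by simp
  qed
  define E where "E K l = {x\<in>space seq_space. \<exists>n\<ge>1. inj_sum d (r K) n x > l * real n ^ d}" for K l
  have rM: "r K \<in> borel_measurable (PiM {1..d} (\<lambda>_. M))" for K
    using \<open>\<And>K. r K \<in> borel_measurable Q\<close> by (simp add: Q_def)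
  have E [measurable]: "E K l \<in> sets seq_space" for K l
    unfolding E_def using inj_sum_measurable[OF rM] by measurable
  \<comment> \<open>The truncation level \<open>K\<close> may depend on the point. A point that is
    bad for every \<open>K \<ge> K0\<close> lies in all the sets \<open>E K l\<close>, whose
    measures tend to 0 with the mean of \<open>r K\<close>; convergence without any rate
    suffices.\<close>
  have E_null: "AE x in seq_space. \<exists>K. (\<integral>y. r K y \<partial>Q) \<le> l \<and> x \<notin> E K l" if "l > 0" for l
  proof -
    obtain K0 where K0: "\<And>K. K \<ge> K0 \<Longrightarrow> (\<integral>y. r K y \<partial>Q) \<le> l"
      using order_tendstoD(2)[OF r_lim \<open>l > 0\<close>] unfolding eventually_sequentially
      by (metis less_imp_le)
    define N where "N = (\<Inter>K\<in>{K0..}. E K l)"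
    have N: "N \<in> sets seq_space"
      unfolding N_def by (intro sets.countable_INT') auto
    have "measure seq_space N \<le> (\<integral>y. r K y \<partial>Q) / l" if "K \<ge> K0" for K
    proof -
      have "measure seq_space N \<le> measure seq_space (E K l)"
        using that by (intro P.finite_measure_mono) (auto simp: N_def)
      also have "l * measure seq_space (E K l) \<le> (\<integral>y. r K y \<partial>Q)"
        unfolding E_def Q_def
        by (rule inj_sum_maximal) (use r_int in \<open>auto simp: r_def Q_def\<close>)
      then have "measure seq_space (E K l) \<le> (\<integral>y. r K y \<partial>Q) / l"
        using \<open>l > 0\<close> by (simp add: field_simps)
      finally show ?thesis .
    qed
    then have "measure seq_space N \<le> 0"
      using LIMSEQ_le_const[OF tendsto_divide[OF r_lim tendsto_const, of l]] \<open>l > 0\<close> by auto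
    then have "N \<in> null_sets seq_space"
      using N measure_nonneg[of seq_space N] by (simp add: null_sets_def P.emeasure_eq_measure)
    then show ?thesis
      by (rule AE_I') (use K0 in \<open>auto simp: N_def\<close>)
  qed
  have "AE x in seq_space. \<forall>p. \<exists>K. (\<integral>y. r K y \<partial>Q) \<le> 1 / real (Suc p) \<and> x \<notin> E K (1 / real (Suc p))"
    by (subst AE_all_countable) (intro allI E_null, simp)
  \<comment> \<open>One null set has to serve all \<open>K\<close>, since the level chosen above
    varies with the point.\<close>
  moreover have "AE x in seq_space. \<forall>K.
      (\<lambda>n. coord_U d (t K) n x / real n ^ d) \<longlonglongrightarrow> (\<integral>x. t K x \<partial>Q) / fact d"
    unfolding Q_def
    by (subst AE_all_countable, intro allI slln_bounded[OF _ _ d])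
      (use \<open>\<And>K. t K \<in> borel_measurable Q\<close> in \<open>auto simp: t_def Q_def\<close>)
  moreover have "AE x in seq_space. x \<in> space seq_space" by simp
  ultimately show ?thesis
  proof eventually_elim
    case (elim x)
    show ?case
    proof (rule LIMSEQ_I)
      fix e :: real assume "e > 0"
      then obtain p where p: "1 / real (Suc p) < e / 3"
        using nat_approx_posE[of "e / 3"] by auto
      define l where "l = 1 / real (Suc p)"
      obtain K where K: "(\<integral>y. r K y \<partial>Q) \<le> l" "x \<notin> E K l"
        using elim(1) unfolding l_def by blast
      have mean: "\<bar>(\<integral>x. t K x \<partial>Q) / fact d - (\<integral>x. f x \<partial>Q) / fact d\<bar> \<le> l"
      proof -
        have "\<bar>(\<integral>x. t K x \<partial>Q) - (\<integral>x. f x \<partial>Q)\<bar> = \<bar>\<integral>x. f x - t K x \<partial>Q\<bar>"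
          using t_int fQ by (simp add: abs_minus_commute)
        also have "\<dots> \<le> (\<integral>y. r K y \<partial>Q)" unfolding r_def by (rule integral_abs_bound)
        also have "\<dots> \<le> l * fact d"
          using K(1) mult_left_mono[of 1 "fact d" l] by (simp add: l_def fact_ge_1)
        finally show ?thesis by (simp add: field_simps flip: diff_divide_distrib)
      qed
      obtain n0 where n0: "\<And>n. n \<ge> n0 \<Longrightarrow>
          \<bar>coord_U d (t K) n x / real n ^ d - (\<integral>x. t K x \<partial>Q) / fact d\<bar> < e / 3"
        using LIMSEQ_D[OF elim(2)[rule_format, of K], of "e / 3"] \<open>e > 0\<close> by auto
      show "\<exists>no. \<forall>n\<ge>no. norm (coord_U d f n x / real n ^ d - (\<integral>x. f x \<partial>PiM {1..d} (\<lambda>_. M)) / fact d) < e"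
      \<comment> \<open>The 1 excludes \<open>n = 0\<close>, which the maximal inequality does not
        cover and where \<open>real n ^ d\<close> vanishes.\<close>
      proof (intro exI[of _ "max 1 n0"] allI impI)
        fix n assume n: "n \<ge> max 1 n0"
        have "\<bar>coord_U d f n x - coord_U d (t K) n x\<bar> \<le> coord_U d (r K) n x"
          unfolding U_stat_def sum_subtractf[symmetric] r_def by (rule sum_abs)
        also have "\<dots> \<le> inj_sum d (r K) n x"
          unfolding U_stat_def inj_sum_def
          by (intro sum_mono2 incr_indices_subset_inj_indices) (auto simp: r_def)
        also have "\<dots> \<le> l * real n ^ d" using K(2) elim(3) n by (auto simp: E_def not_less)
        finally have "\<bar>coord_U d f n x / real n ^ d - coord_U d (t K) n x / real n ^ d\<bar> \<le> l"
          using n by (simp add: field_simps flip: diff_divide_distrib)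
        moreover have "\<bar>coord_U d (t K) n x / real n ^ d - (\<integral>x. t K x \<partial>Q) / fact d\<bar> < e / 3"
          using n0 n by simp
        ultimately show "norm (coord_U d f n x / real n ^ d - (\<integral>x. f x \<partial>PiM {1..d} (\<lambda>_. M)) / fact d) < e"
          using mean p unfolding l_def[symmetric] Q_def[symmetric] real_norm_def by linarith
      qed
    qed
  qed
qed

end

section \<open>Transfer from the product space to an i.i.d. sequence\<close>

text \<open>\<open>S\<close> supplies the measurable sets, whereas the product measure is built from
  the common law \<open>D\<close> on the same sets. Independence then says that the whole sequence
  has the product law.\<close>

lemma iid_sequence_distr:
  assumes "prob_space M" and "iid_sequence M S X"
  defines "D \<equiv> distr M S (X 1)"
  shows "prob_space D"
    and "(\<lambda>\<omega>. \<lambda>k\<in>{1..}. X k \<omega>) \<in> measurable M (PiM {1..} (\<lambda>_. D))"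
    and "distr M (PiM {1..} (\<lambda>_. D)) (\<lambda>\<omega>. \<lambda>k\<in>{1..}. X k \<omega>) = PiM {1..} (\<lambda>_. D)"
proof -
  interpret prob_space M by fact
  have indep: "indep_vars (\<lambda>_. S) X {1..}" and same: "\<And>i. i \<ge> 1 \<Longrightarrow> distr M S (X i) = D"
    using assms(2) unfolding iid_sequence_def D_def by blast+
  have X: "X k \<in> measurable M S" if "k \<in> {1..}" for k
    using indep that by (auto simp: indep_vars_def)
  show "prob_space D" unfolding D_def by (rule prob_space_distr) (simp add: X)
  have sets: "sets (PiM {1..} (\<lambda>_. S)) = sets (PiM {1..} (\<lambda>_::nat. D))"
    by (intro sets_PiM_cong) (auto simp: D_def)
  have "(\<lambda>\<omega>. \<lambda>k\<in>{1..}. X k \<omega>) \<in> measurable M (PiM {1..} (\<lambda>_. S))"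
    by (intro measurable_restrict X)
  then show "(\<lambda>\<omega>. \<lambda>k\<in>{1..}. X k \<omega>) \<in> measurable M (PiM {1..} (\<lambda>_. D))"
    by (simp only: measurable_cong_sets[OF refl sets])
  have "distr M (PiM {1..} (\<lambda>_. D)) (\<lambda>\<omega>. \<lambda>k\<in>{1..}. X k \<omega>) =
      distr M (PiM {1..} (\<lambda>_. S)) (\<lambda>\<omega>. \<lambda>k\<in>{1..}. X k \<omega>)"
    by (intro distr_cong sets[symmetric]) auto
  also have "\<dots> = PiM {1..} (\<lambda>k. distr M S (X k))"
    using indep_vars_iff_distr_eq_PiM'[of "{1..}" X "\<lambda>_. S"] X indep by auto
  also have "\<dots> = PiM {1..} (\<lambda>_. D)" by (intro PiM_cong refl same) simp
  finally show "distr M (PiM {1..} (\<lambda>_. D)) (\<lambda>\<omega>. \<lambda>k\<in>{1..}. X k \<omega>) = PiM {1..} (\<lambda>_. D)" .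
qed

text \<open>Convergence almost surely depends on the law of the whole sequence only, so the
  statement is pulled back along \<open>T\<close>. Integrability and the mean of \<open>f\<close>
  are matched through the law of the first d coordinates.\<close>

theorem slln_U_stat:
  assumes "prob_space M" and "iid_sequence M S X" and d: "d \<ge> 1"
    and f: "f \<in> borel_measurable (PiM {1..d} (\<lambda>_. S))"
    and int: "integrable M (\<lambda>\<omega>. f (\<lambda>k\<in>{1..d}. X k \<omega>))"
  shows "AE \<omega> in M. (\<lambda>n. U_stat d f X n \<omega> / real n ^ d)
    \<longlonglongrightarrow> (\<integral>\<omega>. f (\<lambda>k\<in>{1..d}. X k \<omega>) \<partial>M) / fact d"
proof -
  define D where "D = distr M S (X 1)"
  define T where "T \<omega> = (\<lambda>k\<in>{1..}. X k \<omega>)" for \<omega>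
  define Y where "Y \<omega> = (\<lambda>k\<in>{1..d}. X k \<omega>)" for \<omega>
  have D: "prob_space D" and T: "T \<in> measurable M (PiM {1..} (\<lambda>_. D))"
    and law: "distr M (PiM {1..} (\<lambda>_. D)) T = PiM {1..} (\<lambda>_. D)"
    using iid_sequence_distr[OF assms(1,2)] by (simp_all add: D_def T_def[abs_def])
  interpret D: prob_space D by (rule D)
  have sets: "sets (PiM {1..d} (\<lambda>_. S)) = sets (PiM {1..d} (\<lambda>_. D))"
    by (intro sets_PiM_cong) (auto simp: D_def)
  have fD: "f \<in> borel_measurable (PiM {1..d} (\<lambda>_. D))"
    using f unfolding measurable_cong_sets[OF sets refl] .
  have r: "(\<lambda>x. \<lambda>k\<in>{1..d}. x k) \<in> measurable (PiM {1..} (\<lambda>_. D)) (PiM {1..d} (\<lambda>_. D))"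
    by (rule restrict_reindex_measurable) auto
  have Y_eq: "(\<lambda>x. \<lambda>k\<in>{1..d}. x k) \<circ> T = Y"
    unfolding T_def Y_def comp_def by (intro ext) auto
  have Y: "Y \<in> measurable M (PiM {1..d} (\<lambda>_. D))"
    using measurable_comp[OF T r] unfolding Y_eq .
  have "PiM {1..d} (\<lambda>_. D) = distr (PiM {1..} (\<lambda>_. D)) (PiM {1..d} (\<lambda>_. D)) (\<lambda>x. \<lambda>k\<in>{1..d}. x k)"
    by (rule D.distr_seq_space_reindex[symmetric]) auto
  also have "\<dots> = distr M (PiM {1..d} (\<lambda>_. D)) Y"
    by (subst law[symmetric]) (simp only: distr_distr[OF r T] Y_eq)
  finally have lawY: "PiM {1..d} (\<lambda>_. D) = distr M (PiM {1..d} (\<lambda>_. D)) Y" .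
  have intD: "integrable (PiM {1..d} (\<lambda>_. D)) f"
    by (subst lawY) (use int in \<open>simp add: integrable_distr_eq[OF Y fD] Y_def\<close>)
  have mean: "(\<integral>x. f x \<partial>PiM {1..d} (\<lambda>_. D)) = (\<integral>\<omega>. f (\<lambda>k\<in>{1..d}. X k \<omega>) \<partial>M)"
    by (subst lawY) (simp add: integral_distr[OF Y fD] Y_def)
  have "AE \<omega> in M. (\<lambda>n. D.coord_U d f n (T \<omega>) / real n ^ d)
      \<longlonglongrightarrow> (\<integral>x. f x \<partial>PiM {1..d} (\<lambda>_. D)) / fact d"
    using D.slln_coord_U[OF intD d] by (intro AE_distrD[OF T]) (simp only: law)
  \<comment> \<open>All entries of a multi-index are at least 1, where the restricted sequence
    \<open>T \<omega>\<close> agrees with \<open>X\<close>.\<close>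
  moreover have "D.coord_U d f n (T \<omega>) = U_stat d f X n \<omega>" for n \<omega>
    unfolding U_stat_def
  proof (intro sum.cong refl arg_cong[of _ _ f] restrict_ext)
    fix i k assume "i \<in> incr_indices d n" "k \<in> {1..d}"
    then have "i k \<in> {1..}" using incr_indices_subset_inj_indices inj_indicesD(2) by blast
    then show "T \<omega> (i k) = X (i k) \<omega>" by (simp add: T_def)
  qed
  ultimately show ?thesis by (simp only: mean)
qed

section \<open>Inverting the strong law\<close>

text \<open>A crossing squeezes \<open>x / real (p x) ^ d\<close> between \<open>u (p x)\<close> and
  \<open>u (Suc (p x))\<close> over the same denominator. The shift by one disappears in the limit,
  so both bounds tend to \<open>c\<close>; then take reciprocals and d-th roots.\<close>

lemma root_asymp_of_crossing:
  fixes u :: "nat \<Rightarrow> real" and p :: "real \<Rightarrow> nat"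
  assumes u: "(\<lambda>n. u n / real n ^ d) \<longlonglongrightarrow> c" and c: "c > 0" and d: "d \<ge> 1"
    and p: "filterlim p at_top at_top"
    and cross: "\<forall>\<^sub>F x in at_top. u (p x) \<le> x \<and> x < u (Suc (p x))"
  shows "((\<lambda>x. real (p x) / x powr (1 / real d)) \<longlongrightarrow> (1 / c) powr (1 / real d)) at_top"
proof -
  have upper: "(\<lambda>n. u (Suc n) / real n ^ d) \<longlonglongrightarrow> c"
  proof (rule Lim_transform_eventually)
    have "(\<lambda>n. real (Suc n) / real n) \<longlonglongrightarrow> 1" by (rule LIMSEQ_Suc_n_over_n)
    from tendsto_mult[OF LIMSEQ_Suc[OF u] tendsto_power[OF this, of d]]
    show "(\<lambda>n. u (Suc n) / real (Suc n) ^ d * (real (Suc n) / real n) ^ d) \<longlonglongrightarrow> c" by simp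
    show "\<forall>\<^sub>F n in sequentially. u (Suc n) / real (Suc n) ^ d * (real (Suc n) / real n) ^ d
        = u (Suc n) / real n ^ d"
      by (intro always_eventually allI) (simp add: power_divide del: of_nat_Suc)
  qed
  have pos: "\<forall>\<^sub>F x in at_top. p x > 0"
    using p[unfolded filterlim_at_top, rule_format, of 1] by eventually_elim simp
  have "((\<lambda>x. x / real (p x) ^ d) \<longlongrightarrow> c) at_top"
  proof (rule tendsto_sandwich[OF _ _ filterlim_compose[OF u p] filterlim_compose[OF upper p]])
    show "\<forall>\<^sub>F x in at_top. u (p x) / real (p x) ^ d \<le> x / real (p x) ^ d"
      using cross by eventually_elim (auto intro: divide_right_mono)
    show "\<forall>\<^sub>F x in at_top. x / real (p x) ^ d \<le> u (Suc (p x)) / real (p x) ^ d"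
      using cross by eventually_elim (auto intro: divide_right_mono)
  qed
  then have "((\<lambda>x. (1 / (x / real (p x) ^ d)) powr (1 / real d)) \<longlongrightarrow> (1 / c) powr (1 / real d)) at_top"
    using c by (intro tendsto_powr tendsto_divide tendsto_const) auto
  then show ?thesis
  proof (rule Lim_transform_eventually)
    show "\<forall>\<^sub>F x in at_top. (1 / (x / real (p x) ^ d)) powr (1 / real d)
        = real (p x) / x powr (1 / real d)"
      using pos eventually_gt_at_top[of 0]
    proof eventually_elim
      case (elim x)
      have "(real (p x) ^ d) powr (1 / real d) = real (p x)"
        using elim d by (simp add: powr_powr flip: powr_realpow)
      then show ?case using elim by (simp add: powr_divide)
    qed
  qed
qed

text \<open>The first index with \<open>u n > x\<close> and the successor of the last index with \<open>u n \<le> x\<close> are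
  both the upper end of a crossing of the level \<open>x\<close>.\<close>

lemma renewal_asymp:
  fixes u :: "nat \<Rightarrow> real"
  assumes u: "(\<lambda>n. u n / real n ^ d) \<longlonglongrightarrow> c" and c: "c > 0" and d: "d \<ge> 1" and u0: "u 0 = 0"
  defines "Nm \<equiv> \<lambda>x. Sup {enat n |n. u n \<le> x}" and "Np \<equiv> \<lambda>x. Inf {enat n |n. u n > x}"
  shows "Nm x < \<infinity>" and "Np x < \<infinity>"
    and "((\<lambda>x. ereal_of_enat (Nm x) / ereal (x powr (1 / real d))) \<longlongrightarrow> ereal ((1 / c) powr (1 / real d))) at_top"
    and "((\<lambda>x. ereal_of_enat (Np x) / ereal (x powr (1 / real d))) \<longlongrightarrow> ereal ((1 / c) powr (1 / real d))) at_top"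
proof -
  have "filterlim (\<lambda>n. u n / real n ^ d * real n ^ d) at_top sequentially"
    using d by (intro filterlim_tendsto_pos_mult_at_top[OF u c] filterlim_pow_at_top
        filterlim_real_sequentially) auto
  then have u_lim: "filterlim u at_top sequentially"
    by (rule filterlim_mono_eventually[OF _ order_refl order_refl])
      (use eventually_gt_at_top[of 0] in \<open>eventually_elim; simp\<close>)
  have fin: "finite {n. u n \<le> x}" for x
  proof -
    obtain n0 where "\<And>n. n \<ge> n0 \<Longrightarrow> u n > x"
      using u_lim unfolding filterlim_at_top_dense eventually_sequentially by blast
    then have "{n. u n \<le> x} \<subseteq> {..<n0}" by (auto simp: not_le[symmetric])
    then show ?thesis by (rule finite_subset) simp
  qed
  have ex: "\<exists>n. u n > x" for x
    using u_lim unfolding filterlim_at_top_dense eventually_sequentially by blast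
  define a where "a x = Max {n. u n \<le> x}" for x
  define b where "b x = (LEAST n. u n > x)" for x
  have Nm_fin: "Nm x < \<infinity>" for x
  proof -
    have "{enat n |n. u n \<le> x} = enat ` {n. u n \<le> x}" by auto
    then have "Nm x \<le> enat (a x)"
      unfolding Nm_def a_def using fin by (auto intro!: Sup_least)
    then show ?thesis by (metis enat_ord_code(4) leD not_le_imp_less order_le_less_trans)
  qed
  then show "Nm x < \<infinity>" .
  \<comment> \<open>For \<open>x > 0\<close> the index 0 belongs to the set, because
    \<open>u 0 = 0\<close>. For an empty set the supremum would be 0 and \<open>Max\<close>
    unspecified.\<close>
  have Nm: "Nm x = enat (a x)" if "x > 0" for x
  proof (rule antisym)
    show "Nm x \<le> enat (a x)" unfolding Nm_def a_def using fin by (auto intro!: Sup_least)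
    have "a x \<in> {n. u n \<le> x}" unfolding a_def using that u0 by (intro Max_in fin) (auto intro: exI[of _ 0])
    then show "enat (a x) \<le> Nm x" unfolding Nm_def by (intro Sup_upper) auto
  qed
  have b: "u (b x) > x" for x
    unfolding b_def by (rule LeastI_ex[OF ex])
  have below_b: "u n \<le> x" if "n < b x" for n x
    using not_less_Least[of n "\<lambda>n. u n > x"] that by (simp add: b_def not_less)
  have Np: "Np x = enat (b x)" for x
  proof (rule antisym)
    show "Np x \<le> enat (b x)" unfolding Np_def using b by (intro Inf_lower) auto
    show "enat (b x) \<le> Np x"
      unfolding Np_def by (rule Inf_greatest) (use below_b in \<open>force simp flip: not_le\<close>)
  qed
  then show "Np x < \<infinity>" by simp
  \<comment> \<open>As \<open>u\<close> need not be monotone, \<open>b x\<close> is pushed past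
    \<open>m\<close> by letting \<open>x\<close> dominate all of \<open>u 0\<close>, ...,
    \<open>u m\<close>.\<close>
  have b_lim: "filterlim b at_top at_top"
    unfolding filterlim_at_top
  proof
    fix m
    show "\<forall>\<^sub>F x in at_top. m \<le> b x"
      using eventually_ge_at_top[of "Max (u ` {..m})"]
    proof eventually_elim
      case (elim x)
      have "u n \<le> x" if "n \<le> m" for n
        using elim that Max_ge[of "u ` {..m}" "u n"] by fastforce
      then show ?case using b[of x] by (metis leD le_cases)
    qed
  qed
  \<comment> \<open>The index after the last low one is high, so the first high index comes no
    later. Divergence of \<open>b\<close> thus passes to \<open>a\<close>.\<close>
  have b_le_a: "b x \<le> Suc (a x)" if "x > 0" for x
  proof -
    have "u (Suc (a x)) > x"
      using Max_ge[OF fin[of x], of "Suc (a x)"] by (force simp: a_def[symmetric] not_le[symmetric])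
    then show ?thesis unfolding b_def by (rule Least_le)
  qed
  have pred_b_lim: "filterlim (\<lambda>x. b x - 1) at_top at_top"
    using b_lim by (rule filterlim_compose[rotated]) (rule filterlim_minus_const_nat_at_top)
  have a_lim: "filterlim a at_top at_top"
  proof (rule filterlim_at_top_mono[OF pred_b_lim])
    show "\<forall>\<^sub>F x in at_top. b x - 1 \<le> a x"
      using eventually_gt_at_top[of 0] by eventually_elim (use b_le_a in force)
  qed
  have "((\<lambda>x. real (a x) / x powr (1 / real d)) \<longlongrightarrow> (1 / c) powr (1 / real d)) at_top"
  proof (rule root_asymp_of_crossing[OF u c d a_lim])
    show "\<forall>\<^sub>F x in at_top. u (a x) \<le> x \<and> x < u (Suc (a x))"
      using eventually_gt_at_top[of 0]
    proof eventually_elim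
      case (elim x)
      have "a x \<in> {n. u n \<le> x}" unfolding a_def using elim u0 by (intro Max_in fin) (auto intro: exI[of _ 0])
      moreover have "Suc (a x) \<notin> {n. u n \<le> x}"
        using Max_ge[OF fin[of x], of "Suc (a x)"] by (force simp: a_def[symmetric])
      ultimately show ?case by auto
    qed
  qed
  then have "((\<lambda>x. ereal (real (a x) / x powr (1 / real d))) \<longlongrightarrow> ereal ((1 / c) powr (1 / real d))) at_top"
    by (rule tendsto_ereal)
  then show "((\<lambda>x. ereal_of_enat (Nm x) / ereal (x powr (1 / real d))) \<longlongrightarrow> ereal ((1 / c) powr (1 / real d))) at_top"
    by (rule Lim_transform_eventually) (use eventually_gt_at_top[of 0] in \<open>eventually_elim; simp add: Nm\<close>)
  \<comment> \<open>This makes \<open>b x - 1\<close> a true predecessor, so that it is the lower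
    end of a crossing.\<close>
  have b_pos: "\<forall>\<^sub>F x in at_top. b x \<ge> 1" using b_lim[unfolded filterlim_at_top] by blast
  have "((\<lambda>x. real (b x - 1) / x powr (1 / real d)) \<longlongrightarrow> (1 / c) powr (1 / real d)) at_top"
  proof (rule root_asymp_of_crossing[OF u c d pred_b_lim])
    show "\<forall>\<^sub>F x in at_top. u (b x - 1) \<le> x \<and> x < u (Suc (b x - 1))"
      using b_pos by eventually_elim (use b below_b in auto)
  qed
  \<comment> \<open>The cost of returning from \<open>b x - 1\<close> to \<open>b x\<close>.\<close>
  moreover have "((\<lambda>x. 1 / x powr (1 / real d)) \<longlongrightarrow> 0) at_top"
    using d by real_asymp
  ultimately have "((\<lambda>x. real (b x - 1) / x powr (1 / real d) + 1 / x powr (1 / real d))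
      \<longlongrightarrow> (1 / c) powr (1 / real d) + 0) at_top"
    by (rule tendsto_add)
  then have "((\<lambda>x. real (b x) / x powr (1 / real d)) \<longlongrightarrow> (1 / c) powr (1 / real d) + 0) at_top"
    by (rule Lim_transform_eventually)
      (use b_pos in \<open>eventually_elim; simp add: of_nat_diff flip: add_divide_distrib\<close>)
  then have "((\<lambda>x. ereal (real (b x) / x powr (1 / real d))) \<longlongrightarrow> ereal ((1 / c) powr (1 / real d))) at_top"
    by (intro tendsto_ereal) simp
  then show "((\<lambda>x. ereal_of_enat (Np x) / ereal (x powr (1 / real d))) \<longlongrightarrow> ereal ((1 / c) powr (1 / real d))) at_top"
    by (rule Lim_transform_eventually) (use eventually_gt_at_top[of 0] in \<open>eventually_elim; simp add: Np\<close>)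
qed

theorem theorem3p7:
  fixes M :: "'a measure" and S :: "'s measure"
    and X :: "nat \<Rightarrow> 'a \<Rightarrow> 's" and d :: nat
    and f :: "(nat \<Rightarrow> 's) \<Rightarrow> real" and \<mu> :: real
  assumes "prob_space M"
    and "iid_sequence M S X"
    and "d \<ge> 1"
    and "f \<in> borel_measurable (PiM {1..d} (\<lambda>_. S))"
    and "integrable M (\<lambda>\<omega>. f (\<lambda>k\<in>{1..d}. X k \<omega>))"
    and "\<mu> = (\<integral>\<omega>. f (\<lambda>k\<in>{1..d}. X k \<omega>) \<partial>M)"
    and "\<mu> > 0"
  shows "(AE \<omega> in M. \<forall>x>0. N_minus d f X x \<omega> < \<infinity> \<and> N_plus d f X x \<omega> < \<infinity>) \<and>
    (AE \<omega> in M. ((\<lambda>x. ereal_of_enat (N_minus d f X x \<omega>) / ereal (x powr (1 / real d)))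
        \<longlongrightarrow> ereal ((fact d / \<mu>) powr (1 / real d))) at_top) \<and>
    (AE \<omega> in M. ((\<lambda>x. ereal_of_enat (N_plus d f X x \<omega>) / ereal (x powr (1 / real d)))
        \<longlongrightarrow> ereal ((fact d / \<mu>) powr (1 / real d))) at_top)"
proof -
  define c where "c = \<mu> / fact d"
  have c: "c > 0" "fact d / \<mu> = 1 / c" using assms(7) by (simp_all add: c_def)
  \<comment> \<open>Here \<open>d \<ge> 1\<close> matters: for \<open>d = 0\<close> the empty tuple
    would contribute a term.\<close>
  have U0: "U_stat d f X 0 \<omega> = 0" for \<omega>
    using assms(3) by (simp add: U_stat_def incr_indices_empty)
  have lim: "AE \<omega> in M. (\<lambda>n. U_stat d f X n \<omega> / real n ^ d) \<longlonglongrightarrow> c"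
    using slln_U_stat[OF assms(1-5)] unfolding c_def assms(6) .
  \<comment> \<open>The inversion is deterministic and treats all levels \<open>x\<close> along a
    fixed path, so the null set of the strong law is the only exceptional set.\<close>
  note ra = renewal_asymp[where u = "\<lambda>n. U_stat d f X n \<omega>" for \<omega>, OF _ c(1) assms(3) U0]
  show ?thesis
    unfolding N_minus_def N_plus_def c(2)
    by (intro conjI; use lim in eventually_elim) (blast intro: ra)+
qed

end
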